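(* For fixed $t,y\in\mathbb{R}$ let $\varphi_{t,y}(x)=e^{-2t^3/3-(x+y)t}\,\mathrm{Ai}(x+y+t^2)$. Then for all $s,t>0$ (and all $x,y\in\mathbb{R}$) we have $$e^{s\Delta}\varphi_{t,y}(x)=\varphi_{t-s,y}(x).$$ In particular, $e^{t\Delta}\varphi_{t,y}(x)=\mathrm{Ai}(x+y)$, and as a consequence the kernel $e^{-t\Delta}B_0$ is well defined for every $t>0$ via the formula $$(e^{-t\Delta}B_0)(x,y)=e^{-2t^3/3-(x+y)t}\,\mathrm{Ai}(x+y+t^2),$$ and it satisfies the group property in the sense that $e^{(s+t)\Delta}B_0=e^{s\Delta}e^{t\Delta}B_0$ for all $s,t\in\mathbb{R}$.
   Context: $\mathrm{Ai}$ is the Airy function, $\Delta=\partial_x^2$, and $B_0$ has kernel $B_0(x,y)=\mathrm{Ai}(x+y)$. For $s>0$, $e^{s\Delta}$ is the heat operator, $e^{s\Delta}f(x)=\int_{-\infty}^\infty\frac{1}{\sqrt{4\pi s}}e^{-(x-z)^2/(4s)}f(z)\,dz$, and $e^{0\Delta}=I$. For $s>0$, $(e^{s\Delta}B_0)(\cdot,y)$ is $e^{s\Delta}$ applied to $x\mapsto B_0(x,y)$ for each fixed $y$; operators $e^{s\Delta}$ always act on the first variable of a kernel. For $s<0$, the action of $e^{s\Delta}$ is only considered on kernels of the form $(x,y)\mapsto\varphi_{\tau,y}(x)$, $\tau\in\mathbb{R}$, where it is given by $e^{s\Delta}\varphi_{\tau,y}:=\varphi_{\tau-s,y}$ (a function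 whose image under the heat operator $e^{-s\Delta}$ is $\varphi_{\tau,y}$); for $\tau=0$ this is the displayed formula for $e^{-t\Delta}B_0$. *)

theory Defs
  imports "HOL-Analysis.Analysis"
begin

(* The integral over [0, infinity) converges only conditionally, hence the limit. *)
definition airy_Ai :: "real \<Rightarrow> real" where
  "airy_Ai x = Lim at_top (\<lambda>R. (1 / pi) * integral {0..R} (\<lambda>u. cos (u ^ 3 / 3 + x * u)))"

definition heat_kernel :: "real \<Rightarrow> real \<Rightarrow> real \<Rightarrow> real" where
  "heat_kernel s x z = 1 / sqrt (4 * pi * s) * exp (- ((x - z)\<^sup>2) / (4 * s))"

(* The heat operator on functions of one variable; meaningful only for s \<ge> 0. *)
definition heat_op :: "real \<Rightarrow> (real \<Rightarrow> real) \<Rightarrow> real \<Rightarrow> real" where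
  "heat_op s f = (if s = 0 then f else (\<lambda>x. LINT z|lborel. heat_kernel s x z * f z))"

(* The Bochner integral is 0 on non-integrable functions, so convergence is a separate predicate. *)
definition heat_converges :: "real \<Rightarrow> (real \<Rightarrow> real) \<Rightarrow> bool" where
  "heat_converges s f \<longleftrightarrow>
     s = 0 \<or> s > 0 \<and> (\<forall>x. integrable lborel (\<lambda>z. heat_kernel s x z * f z))"

definition airy_phi :: "real \<Rightarrow> real \<Rightarrow> real \<Rightarrow> real" where
  "airy_phi t y x = exp (- 2 * t ^ 3 / 3 - (x + y) * t) * airy_Ai (x + y + t\<^sup>2)"

definition phi_kernel :: "real \<Rightarrow> real \<Rightarrow> real \<Rightarrow> real" where
  "phi_kernel t x y = airy_phi t y x"

definition B0 :: "real \<Rightarrow> real \<Rightarrow> real" where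
  "B0 x y = airy_Ai (x + y)"

(* The operator exp (s \<Delta>) on kernels K x y, acting on the first variable.  For s < 0 it acts
   only on the kernels phi_kernel \<tau>, which it sends to phi_kernel (\<tau> - s). *)
definition exp_laplace :: "real \<Rightarrow> (real \<Rightarrow> real \<Rightarrow> real) \<Rightarrow> real \<Rightarrow> real \<Rightarrow> real" where
  "exp_laplace s K =
     (if s \<ge> 0 then (\<lambda>x y. heat_op s (\<lambda>z. K z y) x)
      else (THE L. \<exists>\<tau>. K = phi_kernel \<tau> \<and> L = phi_kernel (\<tau> - s)))"

(* exp_laplace s K is meaningful: for s > 0 the heat integrals converge; for s < 0 the kernel K is
   some phi_kernel \<tau>, and the result does not depend on the choice of \<tau>. *)
definition exp_laplace_defined :: "real \<Rightarrow> (real \<Rightarrow> real \<Rightarrow> real) \<Rightarrow> bool" where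
  "exp_laplace_defined s K \<longleftrightarrow>
     (if s \<ge> 0 then (\<forall>y. heat_converges s (\<lambda>z. K z y))
      else (\<exists>!L. \<exists>\<tau>. K = phi_kernel \<tau> \<and> L = phi_kernel (\<tau> - s)))"

end

theory Submission
  imports
    Defs
    "HOL-Probability.Characteristic_Functions"
    "HOL-Complex_Analysis.Cauchy_Integral_Theorem"
    "HOL-Real_Asymp.Real_Asymp"
begin

text \<open>
  The heat operator acts on an exponential \<open>x \<mapsto> exp (- x w)\<close> with complex \<open>w\<close> as multiplication by
  \<open>exp (s w\<^sup>2)\<close>. The functions \<open>\<phi>\<^bsub>t,y\<^esub>\<close> are superpositions of such exponentials: for every \<open>c > t\<close>,
  \<open>\<phi>\<^bsub>t,y\<^esub>(x) = 1/(2 \<pi> i) \<integral> exp (w\<^sup>3/3 - t w\<^sup>2 - (x + y) w) dw\<close> over the vertical line \<open>Re w = c\<close>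
  (\<open>airy_phi_contour_integral\<close>). Applying the heat operator under this integral changes the
  coefficient \<open>- t\<close> of \<open>w\<^sup>2\<close> into \<open>- (t - s)\<close>, which is the asserted formula (\<open>heat_airy_phi\<close>). On
  the line the integrand has modulus a constant times \<open>exp (- (c - t) (Im w)\<^sup>2)\<close>, so that all integrals
  converge absolutely and Fubini applies; the growth and oscillation of the Airy function at minus
  infinity never have to be examined.

  For \<open>t = 0\<close> the contour formula comes from the definition of the Airy function, which is the
  conditionally convergent integral over the imaginary axis: moving the contour to the right costs
  two horizontal segments at height \<open>\<plusminus>R\<close>, whose contribution is \<open>O (1 / R\<^sup>2)\<close>
  (\<open>Ai_contour_integral\<close>). General \<open>t\<close> reduces to this case by the translation
  \<open>w = v + t\<close>, which completes the cube.

  The operator with negative time is well defined because \<open>\<phi>\<^sub>t\<close> determines \<open>t\<close>. If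
  \<open>\<phi>\<^sub>t = \<phi>\<^sub>t\<^sub>'\<close> with \<open>d = t - t' > 0\<close>, the heat flow makes
  \<open>r \<mapsto> \<phi>\<^sub>r(0)\<close> periodic with period \<open>d\<close> on \<open>r \<le> t\<close>, whereas
  \<open>\<phi>\<^bsub>-s\<^esub>(0)\<close> is asymptotic to \<open>1 / (2 \<surd>(\<pi> s))\<close> as \<open>s\<close> grows (\<open>airy_phi_asymptotics\<close>). Once the kernels
  \<open>\<phi>\<^sub>t\<close> are known to be distinct, every \<open>exp (s \<Delta>)\<close>, of either sign, translates their parameter
  by \<open>- s\<close>, and the group property is the additivity of translations.
\<close>

section \<open>Integrals over vertical lines\<close>

text \<open>
  The integrand of the contour integral for \<open>\<phi>\<^sub>t\<close>, on the line \<open>Re w = c\<close> parametrised by the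
  imaginary part \<open>u\<close>. With this parametrisation \<open>dw = i du\<close>, so the prefactor is
  \<open>1 / (2 \<pi>)\<close> rather than \<open>1 / (2 \<pi> i)\<close>.
\<close>
definition airy_wave :: "real \<Rightarrow> real \<Rightarrow> real \<Rightarrow> real \<Rightarrow> complex" where
  "airy_wave c t x u =
     (let w = Complex c u in exp (w ^ 3 / 3 - of_real t * w\<^sup>2 - of_real x * w))"

text \<open>
  The real part of \<open>w\<^sup>3/3 - t w\<^sup>2\<close> contains \<open>(t - c) u\<^sup>2\<close>: this is why the line must lie to the
  right of \<open>t\<close>, and it is the only source of convergence.
\<close>
lemma norm_airy_wave:
  "norm (airy_wave c t x u) = exp (c ^ 3 / 3 - t * c\<^sup>2 - x * c) * exp (- (c - t) * u\<^sup>2)"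
proof -
  have "Re (Complex c u ^ 3 / 3 - of_real t * (Complex c u)\<^sup>2 - of_real x * Complex c u)
      = (c ^ 3 / 3 - t * c\<^sup>2 - x * c) + - (c - t) * u\<^sup>2"
    by (simp add: power2_eq_square power3_eq_cube algebra_simps diff_divide_distrib)
  then show ?thesis
    by (simp add: airy_wave_def Let_def flip: exp_add)
qed

lemma continuous_on_airy_wave: "continuous_on A (airy_wave c t x)"
  unfolding airy_wave_def Let_def by (intro continuous_intros) simp_all

lemma borel_measurable_airy_wave [measurable]: "airy_wave c t x \<in> borel_measurable borel"
  by (intro borel_measurable_continuous_onI continuous_on_airy_wave)

lemma has_bochner_integral_gaussian:
  fixes a :: real
  assumes "a > 0"
  shows "has_bochner_integral lborel (\<lambda>u. exp (- a * u\<^sup>2)) (sqrt (pi / a))"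
proof -
  have "has_bochner_integral lborel
      (\<lambda>u. sqrt (pi / a) * normal_density 0 (sqrt (1 / (2 * a))) u) (sqrt (pi / a) * 1)"
    using assms
    by (intro has_bochner_integral_mult_right) (auto simp: has_bochner_integral_iff)
  also have "(\<lambda>u. sqrt (pi / a) * normal_density 0 (sqrt (1 / (2 * a))) u) = (\<lambda>u. exp (- a * u\<^sup>2))"
    using assms by (auto simp: normal_density_def mult.commute)
  finally show ?thesis by simp
qed

lemma integrable_airy_wave:
  assumes "c > t"
  shows "integrable lborel (airy_wave c t x)"
proof (rule Bochner_Integration.integrable_bound)
  show "integrable lborel (\<lambda>u. exp (c ^ 3 / 3 - t * c\<^sup>2 - x * c) * exp (- (c - t) * u\<^sup>2))"
    using assms
    by (intro integrable_mult_right integrable.intros[OF has_bochner_integral_gaussian]) auto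
qed (auto simp: norm_airy_wave)

section \<open>The Airy function as a contour integral\<close>

lemma symmetric_integral_tendsto:
  fixes f :: "real \<Rightarrow> complex"
  assumes f: "integrable lborel f"
  shows "((\<lambda>R. integral {-R..R} f) \<longlongrightarrow> (LINT u|lborel. f u)) at_top"
proof -
  have [measurable]: "f \<in> borel_measurable borel"
    using f by auto
  have "integral {-R..R} f = (LINT u|lborel. indicator {-R..R} u *\<^sub>R f u)" for R
    using set_borel_integral_eq_integral(2)[of "{-R..R}" f] f
    by (simp add: set_integrable_def set_lebesgue_integral_def integrable_mult_indicator)
  moreover have "((\<lambda>R. LINT u|lborel. indicator {-R..R} u *\<^sub>R f u) \<longlongrightarrow> (LINT u|lborel. f u)) at_top"
  proof (rule integral_dominated_convergence_at_top)
    show "integrable lborel (\<lambda>u. norm (f u))"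
      using f by simp
    show "AE u in lborel. ((\<lambda>R. indicator {-R..R} u *\<^sub>R f u) \<longlongrightarrow> f u) at_top"
    proof (intro AE_I2 tendsto_eventually)
      fix u :: real
      show "\<forall>\<^sub>F R in at_top. indicator {-R..R} u *\<^sub>R f u = f u"
        using eventually_ge_at_top[of "\<bar>u\<bar>"] by eventually_elim (auto simp: indicator_def)
    qed
  qed (auto intro!: always_eventually split: split_indicator)
  ultimately show ?thesis by simp
qed

lemma integral_symmetric_fold:
  fixes f :: "real \<Rightarrow> complex"
  assumes f: "continuous_on UNIV f" and R: "R \<ge> 0"
  shows "integral {-R..R} f = integral {0..R} (\<lambda>u. f u + f (- u))"
proof -
  have int: "f integrable_on {a..b}" "(\<lambda>u. f (- u)) integrable_on {a..b}" for a b
    by (auto intro!: integrable_continuous_real continuous_on_compose2[OF f] continuous_intros)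
  have "integral {-R..R} f = integral {-R..0} f + integral {0..R} f"
    using R int by (intro Henstock_Kurzweil_Integration.integral_combine[symmetric]) auto
  also have "integral {-R..0} f = integral {0..R} (\<lambda>u. f (- u))"
    using Henstock_Kurzweil_Integration.integral_reflect_real[of R 0 "\<lambda>u. f (- u)"] by simp
  finally show ?thesis
    using int by (simp add: integral_add add.commute)
qed

text \<open>
  On the horizontal segment at height \<open>R\<close> the modulus is at most a constant times
  \<open>exp (- R\<^sup>2 v)\<close>, where \<open>v\<close> is the real part. There is no decay at the end \<open>v = 0\<close> on the imaginary
  axis, but integrating the exponential over \<open>v\<close> gains the factor \<open>1 / R\<^sup>2\<close>.
\<close>
lemma airy_wave_horizontal_segment_bound:
  assumes "c \<ge> 0" "R \<noteq> 0"
  shows "norm (integral {0..c} (\<lambda>v. airy_wave v 0 x R)) \<le> exp (c ^ 3 / 3 + \<bar>x\<bar> * c) / R\<^sup>2"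
proof -
  let ?M = "exp (c ^ 3 / 3 + \<bar>x\<bar> * c)"
  have cont: "continuous_on {0..c} (\<lambda>v. airy_wave v 0 x R)"
    unfolding airy_wave_def Let_def by (intro continuous_intros) simp_all
  have F: "((\<lambda>v. ?M * exp (- (R\<^sup>2) * v)) has_integral
       (- (?M * exp (- (R\<^sup>2) * c) / R\<^sup>2)) - (- (?M * exp (- (R\<^sup>2) * 0) / R\<^sup>2))) {0..c}"
    using assms
    by (intro fundamental_theorem_of_calculus)
       (auto intro!: derivative_eq_intros simp: power2_eq_square power4_eq_xxxx
             simp flip: has_real_derivative_iff_has_vector_derivative)
  have "norm (integral {0..c} (\<lambda>v. airy_wave v 0 x R)) \<le> integral {0..c} (\<lambda>v. ?M * exp (- (R\<^sup>2) * v))"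
  proof (rule integral_norm_bound_integral)
    fix v assume v: "v \<in> {0..c}"
    have "v ^ 3 / 3 \<le> c ^ 3 / 3"
      using v by (auto intro!: power_mono)
    moreover have "- x * v \<le> \<bar>x\<bar> * c"
      using v by (intro mult_mono) auto
    ultimately have "exp (v ^ 3 / 3 - x * v) \<le> ?M"
      by simp
    then show "norm (airy_wave v 0 x R) \<le> ?M * exp (- (R\<^sup>2) * v)"
      by (simp add: norm_airy_wave mult.commute)
  qed (use cont F in \<open>auto intro: integrable_continuous_real\<close>)
  also have "\<dots> = ?M / R\<^sup>2 - ?M * exp (- (R\<^sup>2) * c) / R\<^sup>2"
    using integral_unique[OF F] by simp
  also have "\<dots> \<le> ?M / R\<^sup>2"
    by simp
  finally show ?thesis .
qed

text \<open>
  Cauchy's theorem for the rectangle with vertices \<open>\<plusminus>iR\<close> and \<open>c \<plusminus> iR\<close>. Since the integrand is entire it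
  has a primitive \<open>g\<close>, and the integral over each side is a difference of values of \<open>g\<close> at
  the corners.
\<close>
lemma airy_wave_shift_difference:
  assumes "c \<ge> 0" "R \<ge> 0"
  shows "integral {-R..R} (airy_wave c 0 x) - integral {-R..R} (airy_wave 0 0 x) =
     - \<i> * (integral {0..c} (\<lambda>v. airy_wave v 0 x R) - integral {0..c} (\<lambda>v. airy_wave v 0 x (- R)))"
proof -
  define f where "f w = exp (w ^ 3 / 3 - of_real x * w)" for w :: complex
  have wave: "airy_wave v 0 x u = f (Complex v u)" for v u
    by (simp add: airy_wave_def f_def Let_def)
  have "f holomorphic_on UNIV"
    unfolding f_def by (intro holomorphic_intros) auto
  then obtain g where g: "\<And>w. (g has_field_derivative f w) (at w)"
    using holomorphic_convex_primitive'[of UNIV f] by auto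
  have g': "((\<lambda>u. g (p u)) has_vector_derivative (p' * f (p u))) (at u within A)"
    if "(p has_vector_derivative p') (at u within A)" for p :: "real \<Rightarrow> complex" and p' u A
    using field_vector_diff_chain_within[OF that has_field_derivative_at_within[OF g]]
    by (simp add: o_def)
  have horizontal: "integral {0..c} (\<lambda>v. airy_wave v 0 x S) = g (Complex c S) - g (Complex 0 S)" for S
  proof (intro integral_unique fundamental_theorem_of_calculus)
    fix v :: real
    have "((\<lambda>v. Complex v S) has_vector_derivative 1) (at v within {0..c})"
      unfolding Complex_eq by (auto intro!: derivative_eq_intros)
    from g'[OF this] show "((\<lambda>v. g (Complex v S)) has_vector_derivative airy_wave v 0 x S) (at v within {0..c})"
      by (simp add: wave)
  qed (use assms in auto)
  have vertical: "integral {-R..R} (airy_wave v 0 x) = - \<i> * (g (Complex v R) - g (Complex v (- R)))" for v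
  proof -
    have "((\<lambda>u. \<i> * airy_wave v 0 x u) has_integral g (Complex v R) - g (Complex v (- R))) {-R..R}"
    proof (intro fundamental_theorem_of_calculus)
      fix u :: real
      have "((\<lambda>u. Complex v u) has_vector_derivative \<i>) (at u within {-R..R})"
        unfolding Complex_eq by (auto intro!: derivative_eq_intros)
      from g'[OF this] show "((\<lambda>u. g (Complex v u)) has_vector_derivative \<i> * airy_wave v 0 x u) (at u within {-R..R})"
        by (simp add: wave)
    qed (use assms in auto)
    from has_integral_mult_right[OF this, of "- \<i>"] show ?thesis
      by (auto simp flip: mult.assoc dest!: integral_unique)
  qed
  show ?thesis
    by (simp add: horizontal vertical algebra_simps)
qed

text \<open>
  Folding the integral over \<open>[-iR, iR]\<close> at \<open>0\<close> gives the truncated cosine integral in the definition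
  of the Airy function; the contour shift shows that the limit exists and identifies it.
\<close>
lemma Ai_contour_integral:
  assumes c: "c > 0"
  shows "of_real (airy_Ai x) = 1 / (2 * of_real pi) * (LINT u|lborel. airy_wave c 0 x u)"
proof -
  let ?L = "LINT u|lborel. airy_wave c 0 x u"
  let ?J = "\<lambda>R. integral {0..c} (\<lambda>v. airy_wave v 0 x R) - integral {0..c} (\<lambda>v. airy_wave v 0 x (- R))"
  define A where "A R = (1 / pi) * integral {0..R} (\<lambda>u. cos (u ^ 3 / 3 + x * u))" for R
  have J: "(?J \<longlongrightarrow> 0) at_top"
  proof (rule Lim_null_comparison)
    let ?M = "exp (c ^ 3 / 3 + \<bar>x\<bar> * c)"
    show "\<forall>\<^sub>F R in at_top. norm (?J R) \<le> 2 * (?M / R\<^sup>2)"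
      using eventually_gt_at_top[of 0]
    proof eventually_elim
      case (elim R)
      then show ?case
        using airy_wave_horizontal_segment_bound[of c R x] airy_wave_horizontal_segment_bound[of c "- R" x] c
        by (intro norm_triangle_le_diff) auto
    qed
    show "((\<lambda>R::real. 2 * (?M / R\<^sup>2)) \<longlongrightarrow> 0) at_top"
      by real_asymp
  qed
  have "((\<lambda>R. integral {-R..R} (airy_wave c 0 x) - (- \<i> * ?J R)) \<longlongrightarrow> ?L - (- \<i> * 0)) at_top"
    by (intro tendsto_intros J symmetric_integral_tendsto integrable_airy_wave c)
  moreover have "\<forall>\<^sub>F R in at_top. integral {-R..R} (airy_wave c 0 x) - (- \<i> * ?J R) = of_real (2 * pi * A R)"
    using eventually_ge_at_top[of 0]
  proof eventually_elim
    case (elim R)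
    have "integral {-R..R} (airy_wave c 0 x) - (- \<i> * ?J R) = integral {-R..R} (airy_wave 0 0 x)"
      using airy_wave_shift_difference[of c R x] c elim by (simp add: algebra_simps)
    also have "\<dots> = integral {0..R} (\<lambda>u. airy_wave 0 0 x u + airy_wave 0 0 x (- u))"
      using elim by (intro integral_symmetric_fold continuous_on_airy_wave)
    also have "(\<lambda>u. airy_wave 0 0 x u + airy_wave 0 0 x (- u)) = (\<lambda>u. of_real (2 * cos (u ^ 3 / 3 + x * u)))"
    proof
      fix u
      have "airy_wave 0 0 x u = cis (- (u ^ 3 / 3 + x * u))" for u
        unfolding airy_wave_def Let_def cis_conv_exp
        by (rule arg_cong[where f = exp]) (simp add: complex_eq_iff power3_eq_cube algebra_simps)
      from this[of u] this[of "- u"]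
      have "airy_wave 0 0 x u = cis (- (u ^ 3 / 3 + x * u))"
        and "airy_wave 0 0 x (- u) = cis (u ^ 3 / 3 + x * u)"
        by (simp_all add: add.commute)
      then show "airy_wave 0 0 x u + airy_wave 0 0 x (- u) = of_real (2 * cos (u ^ 3 / 3 + x * u))"
        by (simp only:) (simp add: complex_eq_iff del: minus_add_distrib)
    qed
    also have "integral {0..R} (\<lambda>u. of_real (2 * cos (u ^ 3 / 3 + x * u))) = (of_real (2 * pi * A R) :: complex)"
      unfolding A_def
      by (subst integral_unique[OF has_integral_of_real[OF integrable_integral]])
         (auto intro!: integrable_continuous_real continuous_intros)
    finally show ?case .
  qed
  ultimately have lim: "((\<lambda>R. of_real (2 * pi * A R) :: complex) \<longlongrightarrow> ?L) at_top"
    by (simp add: tendsto_cong)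
  then have limA: "((\<lambda>R. of_real (A R) :: complex) \<longlongrightarrow> 1 / (2 * of_real pi) * ?L) at_top"
    using tendsto_mult_left[OF lim, of "1 / (2 * of_real pi)"] by simp
  then have "(A \<longlongrightarrow> Re (1 / (2 * of_real pi) * ?L)) at_top"
    using tendsto_Re by fastforce
  then have "airy_Ai x = Re (1 / (2 * of_real pi) * ?L)"
    unfolding airy_Ai_def A_def by (intro tendsto_Lim) auto
  moreover have "Im (1 / (2 * of_real pi) * ?L) = 0"
    using tendsto_Im[OF limA] by (simp add: tendsto_const_iff)
  ultimately show ?thesis
    by (simp add: complex_eq_iff)
qed


text \<open>
  With \<open>w = v + t\<close> one has
  \<open>w\<^sup>3/3 - t w\<^sup>2 - X w = (v\<^sup>3/3 - (X + t\<^sup>2) v) + (- 2 t\<^sup>3/3 - X t)\<close>, which is the Airy exponent at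
  \<open>X + t\<^sup>2\<close> plus the exponent of the prefactor of \<open>\<phi>\<^sub>t\<close>.
\<close>
lemma airy_phi_contour_integral:
  assumes c: "c > t"
  shows "of_real (airy_phi t y x) = 1 / (2 * of_real pi) * (LINT u|lborel. airy_wave c t (x + y) u)"
proof -
  let ?X = "x + y"
  let ?e = "exp (- 2 * t ^ 3 / 3 - ?X * t)"
  have "airy_wave c t ?X u = of_real ?e * airy_wave (c - t) 0 (?X + t\<^sup>2) u" for u
  proof -
    define T where "T = complex_of_real t"
    define v where "v = Complex (c - t) u"
    have v: "Complex c u = v + T"
      by (simp add: v_def T_def complex_eq_iff)
    have "(v + T) ^ 3 / 3 - T * (v + T)\<^sup>2 - of_real ?X * (v + T)
        = (- 2 * T ^ 3 / 3 - of_real ?X * T) + (v ^ 3 / 3 - of_real ?X * v - T\<^sup>2 * v)"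
      by (simp add: power2_eq_square power3_eq_cube field_simps)
    then have "exp ((v + T) ^ 3 / 3 - T * (v + T)\<^sup>2 - of_real ?X * (v + T))
        = exp (- 2 * T ^ 3 / 3 - of_real ?X * T) * exp (v ^ 3 / 3 - of_real ?X * v - T\<^sup>2 * v)"
      by (simp only: exp_add)
    moreover have "of_real ?e = exp (- 2 * T ^ 3 / 3 - of_real ?X * T)"
      by (simp add: T_def exp_of_real[symmetric])
    moreover have "airy_wave (c - t) 0 (?X + t\<^sup>2) u = exp (v ^ 3 / 3 - of_real ?X * v - T\<^sup>2 * v)"
      by (simp add: airy_wave_def v_def[symmetric] T_def algebra_simps)
    ultimately show ?thesis
      by (simp only: airy_wave_def[of c] Let_def v T_def[symmetric])
  qed
  then have "(LINT u|lborel. airy_wave c t ?X u)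
      = of_real ?e * (LINT u|lborel. airy_wave (c - t) 0 (?X + t\<^sup>2) u)"
    by simp
  also have "\<dots> = of_real ?e * (2 * of_real pi * of_real (airy_Ai (?X + t\<^sup>2)))"
    using c by (subst Ai_contour_integral[of "c - t"]) auto
  finally show ?thesis
    by (simp add: airy_phi_def)
qed

section \<open>The heat operator on the contour integral\<close>

text \<open>
  The Fourier-Laplace transform of a Gaussian. The real part \<open>c\<close> of \<open>w\<close> is absorbed by moving the
  centre of the Gaussian from \<open>x\<close> to \<open>x - 2 s c\<close>; the imaginary part is then
  the characteristic function of the normal distribution.
\<close>
lemma heat_exponential:
  fixes w :: complex
  assumes s: "s > 0"
  shows "has_bochner_integral lborel (\<lambda>z. of_real (heat_kernel s x z) * exp (- of_real z * w))
           (exp (of_real s * w\<^sup>2 - of_real x * w))"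
proof -
  define c b \<sigma> m where "c = Re w" and "b = Im w" and "\<sigma> = sqrt (2 * s)" and "m = x - 2 * s * c"
  let ?f = "\<lambda>z. of_real (heat_kernel s x z) * exp (- of_real z * w)"
  let ?K = "of_real (exp (s * c\<^sup>2 - x * c)) * cis (- m * b) :: complex"
  have \<sigma>: "\<sigma> > 0" "\<sigma>\<^sup>2 = 2 * s"
    using s by (auto simp: \<sigma>_def)
  have w: "w = Complex c b"
    by (simp add: c_def b_def)
  \<comment> \<open>In the standardised variable \<open>v\<close> the weight \<open>exp (- z c)\<close> completes the square in the exponent.\<close>
  have f: "?f (m + \<sigma> * v) = of_real (1 / \<sigma>) * ?K * (std_normal_density v *\<^sub>R iexp ((- \<sigma> * b) * v))" for v
  proof -
    have e1: "exp (- (of_real (m + \<sigma> * v)) * w) = of_real (exp (- (m + \<sigma> * v) * c)) * cis (- (m + \<sigma> * v) * b)"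
      by (simp add: w exp_eq_polar)
    have e2: "cis (- (m + \<sigma> * v) * b) = cis (- m * b) * cis ((- \<sigma> * b) * v)"
      by (simp add: cis_mult algebra_simps)
    have "- (x - (m + \<sigma> * v))\<^sup>2 / (4 * s) + - (m + \<sigma> * v) * c = (s * c\<^sup>2 - x * c) + - v\<^sup>2 / 2"
    proof -
      have "(x - (m + \<sigma> * v))\<^sup>2 = 4 * s\<^sup>2 * c\<^sup>2 - 4 * s * c * \<sigma> * v + 2 * s * v\<^sup>2"
        by (simp add: m_def power2_diff power_mult_distrib \<sigma>(2) algebra_simps)
      then have "(x - (m + \<sigma> * v))\<^sup>2 / (4 * s) = s * c\<^sup>2 - c * \<sigma> * v + v\<^sup>2 / 2"
        using s by (simp add: field_simps power2_eq_square)
      then have "- (x - (m + \<sigma> * v))\<^sup>2 / (4 * s) = - (s * c\<^sup>2 - c * \<sigma> * v + v\<^sup>2 / 2)"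
        by simp
      then show ?thesis
        by (simp only:) (simp add: m_def power2_eq_square algebra_simps)
    qed
    then have "exp (- (x - (m + \<sigma> * v))\<^sup>2 / (4 * s)) * exp (- (m + \<sigma> * v) * c)
        = exp (s * c\<^sup>2 - x * c) * exp (- v\<^sup>2 / 2)"
      by (simp only: mult_exp_exp)
    moreover have "sqrt (4 * pi * s) = sqrt (2 * pi) * \<sigma>"
      unfolding \<sigma>_def real_sqrt_mult[symmetric] by (simp add: algebra_simps)
    ultimately have "heat_kernel s x (m + \<sigma> * v) * exp (- (m + \<sigma> * v) * c)
        = 1 / \<sigma> * exp (s * c\<^sup>2 - x * c) * std_normal_density v"
      by (simp add: heat_kernel_def std_normal_density_def)
    then have "?f (m + \<sigma> * v)
        = of_real (1 / \<sigma> * exp (s * c\<^sup>2 - x * c) * std_normal_density v) * cis (- (m + \<sigma> * v) * b)"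
      unfolding e1 by (metis (no_types, opaque_lifting) mult.assoc of_real_mult)
    then show ?thesis
      unfolding e2 by (simp add: cis_conv_exp scaleR_conv_of_real mult_ac)
  qed
  have int: "integrable lborel (\<lambda>v. std_normal_density v *\<^sub>R iexp ((- \<sigma> * b) * v))"
  proof (rule Bochner_Integration.integrable_bound)
    show "integrable lborel std_normal_density" by simp
  qed auto
  have "(LINT v|lborel. std_normal_density v *\<^sub>R iexp ((- \<sigma> * b) * v)) = char std_normal_distribution (- \<sigma> * b)"
    unfolding char_def by (subst integral_density) auto
  also have "\<dots> = of_real (exp (- s * b\<^sup>2))"
    by (simp add: char_std_normal_distribution power_mult_distrib \<sigma>(2))
  finally have val: "(LINT v|lborel. std_normal_density v *\<^sub>R iexp ((- \<sigma> * b) * v)) = of_real (exp (- s * b\<^sup>2))" .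
  \<comment> \<open>Undo the substitution \<open>z = m + \<sigma> v\<close>, whose Jacobian \<open>\<sigma>\<close> cancels the factor \<open>1 / \<sigma>\<close> in \<open>f\<close>.\<close>
  have "integrable lborel (\<lambda>v. ?f (m + \<sigma> * v))"
    unfolding f by (intro integrable_mult_right int)
  then have "integrable lborel ?f"
    using \<sigma>(1) by (subst (asm) lborel_integrable_real_affine_iff) auto
  moreover have "integral\<^sup>L lborel ?f = exp (of_real s * w\<^sup>2 - of_real x * w)"
  proof -
    have "integral\<^sup>L lborel ?f = \<bar>\<sigma>\<bar> *\<^sub>R (LINT v|lborel. ?f (m + \<sigma> * v))"
      using \<sigma>(1) by (intro lborel_integral_real_affine) auto
    also have "(LINT v|lborel. ?f (m + \<sigma> * v)) = of_real (1 / \<sigma>) * ?K * of_real (exp (- s * b\<^sup>2))"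
      unfolding f val[symmetric] by (rule integral_mult_right_zero)
    also have "\<bar>\<sigma>\<bar> *\<^sub>R \<dots> = of_real (exp (s * c\<^sup>2 - x * c) * exp (- s * b\<^sup>2)) * cis (- m * b)"
      using \<sigma>(1) by (simp add: scaleR_conv_of_real)
    also have "\<dots> = exp (of_real s * w\<^sup>2 - of_real x * w)"
      by (simp add: w exp_eq_polar m_def power2_eq_square algebra_simps flip: exp_add)
    finally show ?thesis .
  qed
  ultimately show ?thesis
    by (simp add: has_bochner_integral_iff)
qed

lemma airy_wave_add:
  "airy_wave c t (z + y) u = exp (- of_real z * Complex c u) * airy_wave c t y u"
  by (simp add: airy_wave_def Let_def algebra_simps flip: exp_add)

lemma heat_airy_wave:
  assumes "s > 0"
  shows "(LINT z|lborel. of_real (heat_kernel s x z) * airy_wave c t (z + y) u)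
           = airy_wave c (t - s) (x + y) u"
proof -
  let ?w = "Complex c u"
  have "(LINT z|lborel. of_real (heat_kernel s x z) * airy_wave c t (z + y) u)
      = (LINT z|lborel. of_real (heat_kernel s x z) * exp (- of_real z * ?w)) * airy_wave c t y u"
    unfolding airy_wave_add mult.assoc[symmetric] by (rule integral_mult_left_zero)
  also have "(LINT z|lborel. of_real (heat_kernel s x z) * exp (- of_real z * ?w))
      = exp (of_real s * ?w\<^sup>2 - of_real x * ?w)"
    by (rule has_bochner_integral_integral_eq[OF heat_exponential[OF assms]])
  also have "\<dots> * airy_wave c t y u = airy_wave c (t - s) (x + y) u"
    by (simp add: airy_wave_def Let_def algebra_simps flip: exp_add)
  finally show ?thesis .
qed

text \<open>
  The modulus of the integrand is a product of a function of \<open>z\<close>, namely the heat kernel times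
  \<open>exp (- z c)\<close>, and a Gaussian in \<open>u\<close>.
\<close>
lemma integrable_heat_kernel_airy_wave:
  assumes s: "s > 0" and c: "c > t"
  shows "integrable (lborel \<Otimes>\<^sub>M lborel)
           (\<lambda>(z, u). of_real (heat_kernel s x z) * airy_wave c t (z + y) u)"
proof (rule lborel_pair.Fubini_integrable)
  have "airy_wave c t X u =
      exp ((of_real c + \<i> * of_real u) ^ 3 / 3 - of_real t * (of_real c + \<i> * of_real u)\<^sup>2
        - of_real X * (of_real c + \<i> * of_real u))" for X u
    by (simp add: airy_wave_def Let_def Complex_eq)
  then show "(\<lambda>(z, u). of_real (heat_kernel s x z) * airy_wave c t (z + y) u)
      \<in> borel_measurable (lborel \<Otimes>\<^sub>M lborel)"
    by (simp add: heat_kernel_def)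
next
  let ?k = "\<lambda>z. of_real (heat_kernel s x z) * exp (- of_real z * of_real c) :: complex"
  let ?I = "LINT u|lborel. norm (airy_wave c t y u)"
  have "norm (of_real (heat_kernel s x z) * airy_wave c t (z + y) u) = norm (?k z) * norm (airy_wave c t y u)" for z u
    by (simp add: airy_wave_add norm_mult)
  then have "(\<lambda>z. LINT u|lborel. norm (of_real (heat_kernel s x z) * airy_wave c t (z + y) u)) = (\<lambda>z. norm (?k z) * ?I)"
    by simp
  moreover have "integrable lborel (\<lambda>z. norm (?k z) * ?I)"
    using integrable.intros[OF heat_exponential[OF s, of x "of_real c"]]
    by (intro integrable_mult_left integrable_norm) auto
  ultimately show "integrable lborel
      (\<lambda>z. LINT u|lborel. norm (case (z, u) of (z, u) \<Rightarrow> of_real (heat_kernel s x z) * airy_wave c t (z + y) u))"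
    by simp
next
  show "AE z in lborel. integrable lborel
      (\<lambda>u. case (z, u) of (z, u) \<Rightarrow> of_real (heat_kernel s x z) * airy_wave c t (z + y) u)"
    using c by (auto intro!: integrable_airy_wave)
qed

text \<open>
  A contour to the right of \<open>t\<close> is also to the right of \<open>t - s\<close>, so one line represents the function
  and its image. The group property uses the formula for negative \<open>t\<close> as well.
\<close>
lemma heat_airy_phi:
  assumes s: "s > 0"
  shows "integrable lborel (\<lambda>z. heat_kernel s x z * airy_phi t y z)" (is ?int)
    and "heat_op s (airy_phi t y) x = airy_phi (t - s) y x" (is ?eq)
proof -
  define c where "c = t + 1"
  have c: "c > t" "c > t - s"
    using s by (auto simp: c_def)
  let ?f = "\<lambda>z u. of_real (heat_kernel s x z) * airy_wave c t (z + y) u"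
  have f: "integrable (lborel \<Otimes>\<^sub>M lborel) (case_prod ?f)"
    by (rule integrable_heat_kernel_airy_wave[OF s c(1)])
  have phi: "of_real (heat_kernel s x z * airy_phi t y z) = 1 / (2 * of_real pi) * (LINT u|lborel. ?f z u)" for z
    by (simp add: airy_phi_contour_integral[OF c(1)])
  have int: "integrable lborel (\<lambda>z. complex_of_real (heat_kernel s x z * airy_phi t y z))"
    unfolding phi using lborel_pair.integrable_fst'[OF f] by (intro integrable_mult_right) auto
  then show ?int
    using integrable_Re[OF int] by simp
  have "of_real (LINT z|lborel. heat_kernel s x z * airy_phi t y z)
      = (LINT z|lborel. complex_of_real (heat_kernel s x z * airy_phi t y z))"
    by (rule integral_complex_of_real[symmetric])
  also have "\<dots> = 1 / (2 * of_real pi) * (LINT z|lborel. LINT u|lborel. ?f z u)"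
    unfolding phi by (rule integral_mult_right_zero)
  also have "(LINT z|lborel. LINT u|lborel. ?f z u) = (LINT u|lborel. LINT z|lborel. ?f z u)"
    by (rule lborel_pair.Fubini_integral[OF f, symmetric])
  also have "\<dots> = (LINT u|lborel. airy_wave c (t - s) (x + y) u)"
    unfolding heat_airy_wave[OF s] ..
  also have "1 / (2 * of_real pi) * \<dots> = of_real (airy_phi (t - s) y x)"
    by (rule airy_phi_contour_integral[OF c(2), symmetric])
  finally show ?eq
    using s by (simp add: heat_op_def del: of_real_mult)
qed

section \<open>The kernels are pairwise distinct\<close>

text \<open>
  For \<open>t = - s < 0\<close> the imaginary axis itself is an admissible contour, and on it the integrand at
  \<open>x = y = 0\<close> is \<open>exp (- s u\<^sup>2)\<close> times a phase. After rescaling \<open>u = v / \<surd>s\<close> the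
  phase tends to \<open>1\<close>, leaving the Gaussian integral \<open>\<surd>\<pi>\<close>.
\<close>
lemma airy_phi_asymptotics:
  "((\<lambda>s. sqrt s * airy_phi (- s) 0 0) \<longlongrightarrow> 1 / (2 * sqrt pi)) at_top"
proof -
  let ?g = "\<lambda>s v. airy_wave 0 (- s) 0 (v / sqrt s)"
  have g: "?g s v = of_real (exp (- v\<^sup>2)) * exp ((\<i> * of_real (v / sqrt s)) ^ 3 / 3)" if "s > 0" for s v
  proof -
    have "complex_of_real s * (\<i> * of_real (v / sqrt s))\<^sup>2 = of_real (- (s * (v / sqrt s)\<^sup>2))"
      by (simp add: power_mult_distrib power_divide)
    also have "s * (v / sqrt s)\<^sup>2 = v\<^sup>2"
      using that by (simp add: power_divide)
    finally show ?thesis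
      by (simp add: airy_wave_def Complex_eq exp_of_real[symmetric] add.commute flip: exp_add)
  qed
  have "((\<lambda>s. LINT v|lborel. ?g s v) \<longlongrightarrow> (LINT v|lborel. complex_of_real (exp (- 1 * v\<^sup>2)))) at_top"
  proof (rule integral_dominated_convergence_at_top)
    show "integrable lborel (\<lambda>v::real. exp (- 1 * v\<^sup>2))"
      by (rule integrable.intros[OF has_bochner_integral_gaussian]) simp
    show "\<forall>\<^sub>F s in at_top. AE v in lborel. norm (?g s v) \<le> exp (- 1 * v\<^sup>2)"
      using eventually_gt_at_top[of 0]
      by eventually_elim (auto simp: norm_airy_wave power_divide)
    show "AE v in lborel. ((\<lambda>s. ?g s v) \<longlongrightarrow> complex_of_real (exp (- 1 * v\<^sup>2))) at_top"
    proof (rule AE_I2)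
      fix v :: real
      have "((\<lambda>s. v / sqrt s) \<longlongrightarrow> 0) at_top"
        by (intro tendsto_divide_0[OF tendsto_const] filterlim_at_top_imp_at_infinity sqrt_at_top)
      then have "((\<lambda>s. of_real (exp (- v\<^sup>2)) * exp ((\<i> * of_real (v / sqrt s)) ^ 3 / 3)) \<longlongrightarrow>
          of_real (exp (- v\<^sup>2)) * exp ((\<i> * of_real 0) ^ 3 / 3 :: complex)) at_top"
        by (intro tendsto_intros) auto
      moreover have "\<forall>\<^sub>F s in at_top. ?g s v = of_real (exp (- v\<^sup>2)) * exp ((\<i> * of_real (v / sqrt s)) ^ 3 / 3)"
        using eventually_gt_at_top[of 0] by eventually_elim (rule g)
      ultimately show "((\<lambda>s. ?g s v) \<longlongrightarrow> complex_of_real (exp (- 1 * v\<^sup>2))) at_top"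
        by (simp add: tendsto_cong)
    qed
  qed auto
  also have "(LINT v|lborel. complex_of_real (exp (- 1 * v\<^sup>2))) = of_real (sqrt pi)"
    using has_bochner_integral_integral_eq[OF has_bochner_integral_gaussian[of 1]] by simp
  finally have lim: "((\<lambda>s. 1 / (2 * of_real pi) * (LINT v|lborel. ?g s v))
      \<longlongrightarrow> 1 / (2 * of_real pi) * of_real (sqrt pi)) at_top"
    by (intro tendsto_intros)
  have "\<forall>\<^sub>F s in at_top. 1 / (2 * of_real pi) * (LINT v|lborel. ?g s v) = complex_of_real (sqrt s * airy_phi (- s) 0 0)"
    using eventually_gt_at_top[of 0]
  proof eventually_elim
    case (elim s)
    have "(LINT u|lborel. airy_wave 0 (- s) 0 u) = \<bar>1 / sqrt s\<bar> *\<^sub>R (LINT v|lborel. airy_wave 0 (- s) 0 (0 + 1 / sqrt s * v))"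
      using elim by (intro lborel_integral_real_affine) auto
    then show ?case
      using elim airy_phi_contour_integral[of "- s" 0 0 0]
      by (simp add: scaleR_conv_of_real)
  qed
  from Lim_transform_eventually[OF lim this]
  have "((\<lambda>s. complex_of_real (sqrt s * airy_phi (- s) 0 0)) \<longlongrightarrow> of_real (1 / (2 * pi) * sqrt pi)) at_top"
    by simp
  then have "((\<lambda>s. sqrt s * airy_phi (- s) 0 0) \<longlongrightarrow> 1 / (2 * pi) * sqrt pi) at_top"
    unfolding tendsto_of_real_iff .
  also have "1 / (2 * pi) * sqrt pi = 1 / (2 * sqrt pi)"
    by (simp add: field_simps)
  finally show ?thesis .
qed

text \<open>
  Equality would make \<open>r \<mapsto> \<phi>\<^sub>r(0)\<close> periodic towards minus infinity. The values along
  \<open>r = t - n d\<close> are then a constant \<open>a\<close>, but \<open>\<surd>(n d - t) a\<close> cannot have a finite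
  nonzero limit.
\<close>
lemma phi_kernel_neq_of_less:
  assumes "t' < t"
  shows "phi_kernel t \<noteq> phi_kernel t'"
proof
  assume eq: "phi_kernel t = phi_kernel t'"
  define d where "d = t - t'"
  have d: "d > 0"
    using assms by (simp add: d_def)
  have phi_eq: "airy_phi t y = airy_phi t' y" for y
    using eq by (auto simp: phi_kernel_def fun_eq_iff)
  \<comment> \<open>The heat flow for time \<open>t - r\<close> carries the equality from \<open>t\<close> down to every \<open>r \<le> t\<close>.\<close>
  have period: "airy_phi r 0 0 = airy_phi (r - d) 0 0" if "r \<le> t" for r
  proof (cases "r = t")
    case True
    then show ?thesis
      using phi_eq by (simp add: d_def)
  next
    case False
    then have "t - r > 0"
      using that by simp
    from heat_airy_phi(2)[OF this, of t 0 0] heat_airy_phi(2)[OF this, of t' 0 0]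
    show ?thesis
      by (simp add: phi_eq d_def algebra_simps)
  qed
  define a where "a = airy_phi t 0 0"
  define S where "S n = real n * d - t" for n
  have a: "airy_phi (- S n) 0 0 = a" for n
  proof (induction n)
    case 0
    show ?case by (simp add: S_def a_def)
  next
    case (Suc n)
    have "- S n \<le> t" and "- S n - d = - S (Suc n)"
      using d by (auto simp: S_def algebra_simps)
    with period[of "- S n"] Suc show ?case by simp
  qed
  have S: "filterlim S at_top sequentially"
    unfolding S_def using d by real_asymp
  have lim: "(\<lambda>n. sqrt (S n) * a) \<longlonglongrightarrow> 1 / (2 * sqrt pi)"
    using filterlim_compose[OF airy_phi_asymptotics S] by (simp add: a)
  have sqrtS: "filterlim (\<lambda>n. sqrt (S n)) at_infinity sequentially"
    by (intro filterlim_at_top_imp_at_infinity filterlim_compose[OF sqrt_at_top S])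
  have "(\<lambda>n. sqrt (S n) * a / sqrt (S n)) \<longlonglongrightarrow> 0"
    by (rule tendsto_divide_0[OF lim sqrtS])
  moreover have "\<forall>\<^sub>F n in sequentially. sqrt (S n) * a / sqrt (S n) = a"
    using filterlim_at_top_dense[THEN iffD1, OF S, rule_format, of 0] by eventually_elim simp
  ultimately have "a = 0"
    by (simp add: tendsto_cong tendsto_const_iff)
  with lim show False
    by (simp add: tendsto_const_iff)
qed

lemma phi_kernel_eq_iff: "phi_kernel t = phi_kernel t' \<longleftrightarrow> t = t'"
  using phi_kernel_neq_of_less[of t t'] phi_kernel_neq_of_less[of t' t]
  by (metis linorder_neqE_linordered_idom)

section \<open>The group property\<close>

text \<open>
  For negative \<open>s\<close> the translation of the parameter is the definition of the operator, and injectivity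
  of \<open>phi_kernel\<close> makes the description unique.
\<close>
lemma exp_laplace_phi_kernel:
  "exp_laplace_defined s (phi_kernel \<tau>)"
  "exp_laplace s (phi_kernel \<tau>) = phi_kernel (\<tau> - s)"
proof -
  consider "s > 0" | "s = 0" | "s < 0" by linarith
  then have "exp_laplace_defined s (phi_kernel \<tau>) \<and> exp_laplace s (phi_kernel \<tau>) = phi_kernel (\<tau> - s)"
  proof cases
    case 1
    then show ?thesis
      using heat_airy_phi
      by (auto simp: exp_laplace_defined_def exp_laplace_def heat_converges_def phi_kernel_def fun_eq_iff)
  next
    case 2
    then show ?thesis
      by (simp add: exp_laplace_defined_def exp_laplace_def heat_converges_def heat_op_def)
  next
    case 3
    then show ?thesis
      by (auto simp: exp_laplace_defined_def exp_laplace_def phi_kernel_eq_iff)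
  qed
  then show "exp_laplace_defined s (phi_kernel \<tau>)" "exp_laplace s (phi_kernel \<tau>) = phi_kernel (\<tau> - s)"
    by auto
qed

lemma B0_eq_phi_kernel: "B0 = phi_kernel 0"
  by (simp add: B0_def phi_kernel_def airy_phi_def fun_eq_iff)

theorem proposition1p2:
  "(\<forall>s t x y :: real. s > 0 \<and> t > 0 \<longrightarrow>
      heat_converges s (airy_phi t y) \<and>
      heat_op s (airy_phi t y) x = airy_phi (t - s) y x) \<and>
   (\<forall>t x y :: real. t > 0 \<longrightarrow> heat_op t (airy_phi t y) x = airy_Ai (x + y)) \<and>
   (\<forall>t :: real. t > 0 \<longrightarrow>
      exp_laplace_defined (- t) B0 \<and>
      (\<forall>x y. exp_laplace (- t) B0 x y
         = exp (- 2 * t ^ 3 / 3 - (x + y) * t) * airy_Ai (x + y + t\<^sup>2))) \<and>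
   (\<forall>s t :: real.
      exp_laplace_defined (s + t) B0 \<and>
      exp_laplace_defined t B0 \<and>
      exp_laplace_defined s (exp_laplace t B0) \<and>
      exp_laplace (s + t) B0 = exp_laplace s (exp_laplace t B0))"
proof (intro conjI allI impI; (elim conjE)?)
  fix s t x y :: real
  assume "s > 0" "t > 0"
  then show "heat_converges s (airy_phi t y)" "heat_op s (airy_phi t y) x = airy_phi (t - s) y x"
    using heat_airy_phi by (auto simp: heat_converges_def)
next
  fix t x y :: real
  assume "t > 0"
  then show "heat_op t (airy_phi t y) x = airy_Ai (x + y)"
    by (simp add: heat_airy_phi(2) airy_phi_def)
next
  fix t x y :: real
  show "exp_laplace (- t) B0 x y
      = exp (- 2 * t ^ 3 / 3 - (x + y) * t) * airy_Ai (x + y + t\<^sup>2)"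
    by (simp add: B0_eq_phi_kernel exp_laplace_phi_kernel(2)) (simp add: phi_kernel_def airy_phi_def)
next
  fix s t :: real
  have "- (s + t) = - t - s" by simp
  then show "exp_laplace (s + t) B0 = exp_laplace s (exp_laplace t B0)"
    by (simp only: B0_eq_phi_kernel exp_laplace_phi_kernel(2) diff_0)
qed (simp_all add: B0_eq_phi_kernel exp_laplace_phi_kernel)

end
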